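(* For any integer $k\ge 3$, every online algorithm for bin packing with cardinality constraint $k$ has asymptotic competitive ratio at least $$\frac{2k+k^2-k^3+\sqrt{k^6-2k^5-3k^4+12k^3-12k^2+4k}}{2}.$$
   Context: Bin packing with cardinality constraints (CCBP) with integer parameter $k\ge 2$: items with sizes in $(0,1]$ must be partitioned into bins so that each bin has total size at most $1$ and contains at most $k$ items. In the online version items arrive one by one and each must be irrevocably packed (into a new bin or a non-empty bin, respecting both constraints) before the next item arrives. For an input $L$, $A(L)$ denotes the number of bins used by algorithm $A$ and $OPT(L)$ the minimum possible number of bins. The asymptotic competitive ratio of $A$ is $\lim_{K\to\infty}\sup\{A(L)/OPT(L): OPT(L)\ge K\}$. *)

theory Defs
  imports "HOL-Analysis.Extended_Real_Limits"
begin

text \<open>An input is the list of item sizes in order of arrival; items are identified with their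
  positions in the list.  A packing maps positions to bin labels; the bins in use are the
  labels attained.\<close>

definition ccbp_input :: "real list \<Rightarrow> bool" where
  "ccbp_input L \<longleftrightarrow> set L \<subseteq> {0<..1}"

definition feasible_packing :: "nat \<Rightarrow> real list \<Rightarrow> (nat \<Rightarrow> nat) \<Rightarrow> bool" where
  "feasible_packing k L p \<longleftrightarrow>
     (\<forall>b. (\<Sum>i | i < length L \<and> p i = b. L ! i) \<le> 1 \<and>
          card {i. i < length L \<and> p i = b} \<le> k)"

definition num_bins :: "real list \<Rightarrow> (nat \<Rightarrow> nat) \<Rightarrow> nat" where
  "num_bins L p = card (p ` {..<length L})"

definition OPT :: "nat \<Rightarrow> real list \<Rightarrow> nat" where
  "OPT k L = (LEAST m. \<exists>p. feasible_packing k L p \<and> num_bins L p = m)"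

text \<open>A (deterministic) online algorithm is given by the label of the bin chosen for the last item
  of each non-empty list of items that have arrived so far.  The label of an item depends only
  on the list up to and including that item, so decisions are irrevocable and independent of
  the future.  A label not used before means opening a new bin.\<close>

type_synonym online_rule = "real list \<Rightarrow> nat"

definition online_packing :: "online_rule \<Rightarrow> real list \<Rightarrow> nat \<Rightarrow> nat" where
  "online_packing A L i = A (take (Suc i) L)"

definition online_ccbp_algorithm :: "nat \<Rightarrow> online_rule \<Rightarrow> bool" where
  "online_ccbp_algorithm k A \<longleftrightarrow>
     (\<forall>L. ccbp_input L \<longrightarrow> feasible_packing k L (online_packing A L))"

definition alg_bins :: "online_rule \<Rightarrow> real list \<Rightarrow> nat" where
  "alg_bins A L = num_bins L (online_packing A L)"

definition sup_ratio :: "nat \<Rightarrow> online_rule \<Rightarrow> nat \<Rightarrow> ereal" where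
  "sup_ratio k A K =
     (SUP L \<in> {L. ccbp_input L \<and> OPT k L \<ge> K}. ereal (real (alg_bins A L) / real (OPT k L)))"

definition asymptotic_competitive_ratio :: "nat \<Rightarrow> online_rule \<Rightarrow> ereal" where
  "asymptotic_competitive_ratio k A = lim (sup_ratio k A)"

text \<open>The limit always exists, so \<^const>\<open>lim\<close> is not applied outside its domain.\<close>

lemma sup_ratio_tendsto:
  "sup_ratio k A \<longlonglongrightarrow> asymptotic_competitive_ratio k A"
proof -
  have "decseq (sup_ratio k A)"
    unfolding decseq_def sup_ratio_def by (intro allI impI SUP_subset_mono) auto
  then have "sup_ratio k A \<longlonglongrightarrow> (INF K. sup_ratio k A K)"
    by (rule LIMSEQ_INF)
  then show ?thesis
    unfolding asymptotic_competitive_ratio_def using limI by metis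
qed

end

theory Submission imports Defs
begin

text \<open>
  The adversary first presents \<open>N\<close> tiny items, each of size \<open>k\<close> to the power \<open>-e\<close>, and bisects on the
  exponents so that every item opening a new bin is larger than the total size of any \<open>k - 1\<close> of
  the other items.  Let the algorithm use \<open>X\<close> bins, \<open>Z\<close> of them with \<open>k\<close> items, so that
  \<open>N \<le> (k - 1) X + Z\<close>.  The input continues in one of two ways.

  Either \<open>N / (k - 1)\<close> huge items arrive, each fitting together with any \<open>k - 1\<close> tiny items: an
  optimal solution needs \<open>N / (k - 1)\<close> bins, but the algorithm cannot reuse its \<open>Z\<close> full bins.
  Or about \<open>(N - X) / (k - 1)\<close> huge items arrive, each fitting together with \<open>k - 1\<close> items that did
  not open a bin but with no item that did: now the algorithm cannot reuse any of its \<open>X\<close> bins,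
  while \<open>(N - X) / (k - 1) + X / k\<close> bins suffice.

  If \<open>r\<close> bounds both ratios, eliminating \<open>Z\<close> and \<open>X\<close> leaves a quadratic inequality for \<open>r\<close>,
  whose positive root is the claimed bound.
\<close>

subsection \<open>Feasible and optimal packings\<close>

lemma feasible_identity_packing:
  assumes "ccbp_input L" "k \<ge> 1"
  shows "feasible_packing k L (\<lambda>i. i)"
  unfolding feasible_packing_def
proof
  fix b
  have eq: "{i. i < length L \<and> i = b} = (if b < length L then {b} else {})" by auto
  show "(\<Sum>i | i < length L \<and> i = b. L ! i) \<le> 1 \<and> card {i. i < length L \<and> i = b} \<le> k"
    unfolding eq using assms by (auto simp: ccbp_input_def dest: nth_mem)
qed

lemma OPT_le_num_bins:
  assumes "feasible_packing k L p"
  shows "OPT k L \<le> num_bins L p"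
  unfolding OPT_def using assms by (intro Least_le) blast

lemma OPT_attained:
  assumes "ccbp_input L" "k \<ge> 1"
  obtains p where "feasible_packing k L p" "num_bins L p = OPT k L"
proof -
  have "\<exists>p. feasible_packing k L p \<and> num_bins L p = OPT k L"
    unfolding OPT_def
    by (rule LeastI_ex) (use feasible_identity_packing[OF assms] in blast)
  then show ?thesis using that by blast
qed

lemma length_eq_sum_bins:
  "length L = (\<Sum>b\<in>p ` {..<length L}. card {i. i < length L \<and> p i = b})"
proof -
  have "card {..<length L} = (\<Sum>b\<in>p ` {..<length L}. card {i \<in> {..<length L}. p i = b})"
    using sum.group[of "{..<length L}" "p ` {..<length L}" p "\<lambda>_. 1::nat"] by simp
  then show ?thesis by simp
qed

lemma length_le_OPT:
  assumes "ccbp_input L" "k \<ge> 1"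
  shows "length L \<le> k * OPT k L"
proof -
  obtain p where p: "feasible_packing k L p" "num_bins L p = OPT k L"
    using OPT_attained[OF assms] .
  have "length L \<le> (\<Sum>b\<in>p ` {..<length L}. k)"
    by (subst length_eq_sum_bins[of L p], rule sum_mono)
       (use p(1) in \<open>auto simp: feasible_packing_def\<close>)
  also have "\<dots> = k * OPT k L" using p(2) by (simp add: num_bins_def)
  finally show ?thesis .
qed

text \<open>A bin that is not full holds at most \<open>k - 1\<close> items, so only full bins
  contribute one item more.\<close>

lemma length_le_full_bins:
  assumes "feasible_packing k L p" "k \<ge> 1"
  shows "length L \<le> (k - 1) * num_bins L p
    + card {b \<in> p ` {..<length L}. card {i. i < length L \<and> p i = b} = k}"
proof -
  let ?c = "\<lambda>b. card {i. i < length L \<and> p i = b}"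
  have "length L \<le> (\<Sum>b\<in>p ` {..<length L}. (k - 1) + (if ?c b = k then 1 else 0))"
  proof (subst length_eq_sum_bins[of L p], rule sum_mono)
    fix b
    have "?c b \<le> k" using assms(1) by (simp add: feasible_packing_def)
    then show "?c b \<le> (k - 1) + (if ?c b = k then 1 else 0)" using assms(2) by auto
  qed
  also have "\<dots> = (k - 1) * num_bins L p + card {b \<in> p ` {..<length L}. ?c b = k}"
    by (simp add: sum.distrib num_bins_def sum.If_cases Int_def)
  finally show ?thesis .
qed

text \<open>Numbering \<open>S\<close> by a bijection \<open>f\<close> and dividing by
  \<open>d\<close> cuts it into blocks of at most \<open>d\<close> elements. This distributes items
  over \<open>m\<close> bins by count alone.\<close>

lemma bounded_fibres:
  fixes S :: "nat set" and m d :: nat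
  assumes "finite S" "card S \<le> m * d"
  obtains q where "\<And>i. i \<in> S \<Longrightarrow> q i < m" "\<And>b. card {i \<in> S. q i = b} \<le> d"
proof (cases "d = 0")
  case True
  then have "S = {}" using assms by auto
  then show ?thesis using that[of id] by auto
next
  case False
  obtain f where f: "bij_betw f S {..<card S}"
    using ex_bij_betw_finite_nat[OF assms(1)] by (auto simp: atLeast0LessThan)
  have less: "f i div d < m" if "i \<in> S" for i
  proof -
    have "f i < card S" using bij_betwE[OF f] that by blast
    then have "f i < m * d" using assms(2) by linarith
    then show ?thesis by (simp add: less_mult_imp_div_less)
  qed
  have fib: "card {i \<in> S. f i div d = b} \<le> d" for b
  proof -
    have "inj_on f {i \<in> S. f i div d = b}"
      using f by (auto simp: bij_betw_def inj_on_def)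
    moreover have "f ` {i \<in> S. f i div d = b} \<subseteq> {b * d..<b * d + d}"
    proof clarify
      fix i
      show "f i \<in> {(f i div d) * d..<(f i div d) * d + d}"
        using False dividend_less_div_times[of d "f i"] by (simp add: add.commute)
    qed
    ultimately have "card {i \<in> S. f i div d = b} \<le> card {b * d..<b * d + d}"
      by (intro card_inj_on_le) auto
    then show ?thesis by simp
  qed
  show ?thesis by (rule that[of "\<lambda>i. f i div d"]) (use less fib in auto)
qed

text \<open>The witness has \<open>M\<close> bins with one huge item and up to \<open>k - 1\<close>
  items of \<open>S\<close> each, and \<open>Q\<close> bins with up to \<open>k\<close> of the other
  items, which fit because each is at most \<open>1 / k\<close>.\<close>

lemma OPT_append_huge_le:
  fixes xs :: "real list" and s h :: real
  assumes k: "k \<ge> 1"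
    and tiny: "\<And>i. i < length xs \<Longrightarrow> xs ! i \<le> 1 / k"
    and S: "S \<subseteq> {..<length xs}" "\<And>i. i \<in> S \<Longrightarrow> xs ! i \<le> s"
    and h: "h + (real k - 1) * s \<le> 1" "s \<ge> 0"
    and M: "card S \<le> M * (k - 1)"
    and Q: "length xs - card S \<le> Q * k"
  shows "OPT k (xs @ replicate M h) \<le> M + Q"
proof -
  let ?N = "length xs" and ?L = "xs @ replicate M h"
  let ?T = "{..<?N} - S"
  have finS: "finite S" using S(1) finite_subset by blast
  obtain q where q: "\<And>i. i \<in> S \<Longrightarrow> q i < M" "\<And>b. card {i \<in> S. q i = b} \<le> k - 1"
    using bounded_fibres[OF finS M] by blast
  have "card ?T \<le> Q * k" using Q card_Diff_subset[OF finS S(1)] by simp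
  then obtain t where t: "\<And>i. i \<in> ?T \<Longrightarrow> t i < Q" "\<And>b. card {i \<in> ?T. t i = b} \<le> k"
    using bounded_fibres[of ?T Q k] by blast
  \<comment> \<open>Labels below \<open>M\<close> are the bins with a huge item, the next
    \<open>Q\<close> labels the others; the huge item at position \<open>?N + b\<close> goes to bin
    \<open>b\<close>.\<close>
  define p where "p i = (if i \<in> S then q i else if i < ?N then M + t i else i - ?N)" for i
  have "feasible_packing k ?L p"
    unfolding feasible_packing_def
  proof
    fix b
    show "(\<Sum>i | i < length ?L \<and> p i = b. ?L ! i) \<le> 1 \<and> card {i. i < length ?L \<and> p i = b} \<le> k"
    proof (cases "b < M")
      case True
      let ?F = "{i \<in> S. q i = b}"
      have F: "?F \<subseteq> {..<?N}" "finite ?F" using S(1) finS by auto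
      have eq: "{i. i < length ?L \<and> p i = b} = insert (?N + b) ?F"
        using True S(1) by (auto simp: p_def split: if_splits)
      have notin: "?N + b \<notin> ?F" using F by auto
      have "(\<Sum>i\<in>?F. ?L ! i) \<le> card ?F * s"
        using S F by (intro sum_bounded_above) (auto simp: nth_append subset_iff)
      also have "\<dots> \<le> (real k - 1) * s"
        using q(2)[of b] k h(2) by (intro mult_right_mono) linarith+
      finally have "(\<Sum>i\<in>?F. ?L ! i) \<le> (real k - 1) * s" .
      moreover have "?L ! (?N + b) = h" using True by (simp add: nth_append)
      ultimately show ?thesis
        unfolding eq using notin F(2) h(1) q(2)[of b] k by simp
    next
      case False
      let ?F = "{i \<in> ?T. t i = b - M}"
      have F: "{i. i < length ?L \<and> p i = b} = ?F"
        using False S(1) q(1) by (auto simp: p_def split: if_splits)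
      have "(\<Sum>i\<in>?F. ?L ! i) \<le> card ?F * (1 / k)"
        using tiny by (intro sum_bounded_above) (auto simp: nth_append)
      also have "\<dots> \<le> k * (1 / k)"
        using t(2)[of "b - M"] by (intro mult_right_mono) auto
      finally show ?thesis unfolding F using k t(2)[of "b - M"] by simp
    qed
  qed
  then have "OPT k ?L \<le> num_bins ?L p" by (rule OPT_le_num_bins)
  also have "\<dots> \<le> card {..<M + Q}"
    unfolding num_bins_def
  proof (rule card_mono)
    have "p i < M + Q" if "i < length ?L" for i
      using that q(1)[of i] t(1)[of i] by (auto simp: p_def)
    then show "p ` {..<length ?L} \<subseteq> {..<M + Q}" by auto
  qed simp
  finally show ?thesis by simp
qed

subsection \<open>Online algorithms\<close>

text \<open>Two huge items never share a bin since \<open>h > 1 / 2\<close>, and none enters a bin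
  of \<open>B\<close>, which is full or holds an item too large to join \<open>h\<close>. So the
  huge items occupy \<open>M\<close> distinct bins outside \<open>B\<close>.\<close>

lemma num_bins_append_huge_ge:
  fixes xs :: "real list" and h :: real
  assumes feas: "feasible_packing k (xs @ replicate M h) p"
    and h: "h > 1 / 2" and pos: "\<And>x. x \<in> set xs \<Longrightarrow> x \<ge> 0"
    and B: "B \<subseteq> p ` {..<length xs}"
    and blocked: "\<And>b. b \<in> B \<Longrightarrow> card {i. i < length xs \<and> p i = b} = k
                    \<or> (\<exists>i<length xs. p i = b \<and> xs ! i + h > 1)"
  shows "card B + M \<le> num_bins (xs @ replicate M h) p"
proof -
  let ?N = "length xs" and ?L = "xs @ replicate M h"
  let ?H = "{?N..<?N + M}"
  have nonneg: "?L ! i \<ge> 0" if "i < length ?L" for i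
    using that h pos by (auto simp: nth_append)
  have load: "(\<Sum>i\<in>I. ?L ! i) \<le> 1"
    if "I \<subseteq> {i. i < length ?L \<and> p i = b}" for I b
  proof -
    have "(\<Sum>i\<in>I. ?L ! i) \<le> (\<Sum>i | i < length ?L \<and> p i = b. ?L ! i)"
      using that nonneg by (intro sum_mono2) auto
    also have "\<dots> \<le> 1" using feas by (simp add: feasible_packing_def)
    finally show ?thesis .
  qed
  have huge: "?L ! i = h" if "i \<in> ?H" for i
    using that by (auto simp: nth_append)
  have inj: "inj_on p ?H"
  proof (rule inj_onI, rule ccontr)
    fix i j assume ij: "i \<in> ?H" "j \<in> ?H" "p i = p j" "i \<noteq> j"
    have "(\<Sum>i\<in>{i, j}. ?L ! i) \<le> 1" using ij by (intro load[of _ "p i"]) auto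
    then show False using ij huge h by simp
  qed
  have disj: "B \<inter> p ` ?H = {}"
  proof (rule ccontr)
    assume "B \<inter> p ` ?H \<noteq> {}"
    then obtain j where j: "j \<in> ?H" "p j \<in> B" by blast
    show False
      using blocked[OF j(2)]
    proof
      let ?F = "{i. i < ?N \<and> p i = p j}"
      assume "card ?F = k"
      then have "k + 1 = card (insert j ?F)" using j(1) by simp
      also have "\<dots> \<le> card {i. i < length ?L \<and> p i = p j}"
        using j(1) by (intro card_mono) auto
      also have "\<dots> \<le> k" using feas by (simp add: feasible_packing_def)
      finally show False by simp
    next
      assume "\<exists>i<?N. p i = p j \<and> xs ! i + h > 1"
      then obtain i where i: "i < ?N" "p i = p j" "xs ! i + h > 1" by blast
      have "(\<Sum>i\<in>{i, j}. ?L ! i) \<le> 1" using i j by (intro load[of _ "p j"]) auto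
      then show False using i j huge by (simp add: nth_append)
    qed
  qed
  have "finite B" using B finite_subset by blast
  then have "card B + M = card (B \<union> p ` ?H)"
    using disj by (simp add: card_Un_disjoint card_image[OF inj])
  also have "\<dots> \<le> card (p ` {..<length ?L})"
    using B by (intro card_mono) auto
  finally show ?thesis by (simp add: num_bins_def)
qed

lemma online_packing_append:
  "i < length xs \<Longrightarrow> online_packing A (xs @ ys) i = online_packing A xs i"
  by (simp add: online_packing_def)

section \<open>Items that open a bin, and the adaptive choice of sizes\<close>

lemma card_first_occurrences:
  fixes n :: nat
  shows "card {i. i < n \<and> p i \<notin> p ` {..<i}} = card (p ` {..<n})"
proof (induction n)
  case (Suc n)
  have "{i. i < Suc n \<and> p i \<notin> p ` {..<i}} =
      (if p n \<in> p ` {..<n} then {} else {n}) \<union> {i. i < n \<and> p i \<notin> p ` {..<i}}"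
    by (auto simp: less_Suc_eq)
  then show ?case
    using Suc by (auto simp: lessThan_Suc insert_absorb)
qed simp

lemma first_occurrence:
  fixes n :: nat
  assumes "b \<in> p ` {..<n}"
  obtains i where "i < n" "p i = b" "p i \<notin> p ` {..<i}"
proof -
  obtain j where j: "j < n" "p j = b" using assms by auto
  let ?i = "LEAST i. p i = b"
  have "p ?i = b" using j(2) by (rule LeastI)
  moreover have "?i < n" using Least_le[of "\<lambda>i. p i = b" j] j by simp
  moreover have "p ?i \<notin> p ` {..<?i}"
    using \<open>p ?i = b\<close> not_less_Least by fastforce
  ultimately show ?thesis using that by blast
qed

text \<open>Bisection: a new item gets the size in the middle of the current range of indices of \<open>g\<close>, and
  \<open>P\<close>, evaluated on the input so far, decides which half is kept for the later items.\<close>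

lemma adaptive_sizes:
  fixes g :: "nat \<Rightarrow> real" and P :: "real list \<Rightarrow> bool"
  assumes g: "antimono g"
  shows "\<exists>xs c. length xs = n \<and> a \<le> c \<and> set xs \<subseteq> g ` {Suc a..} \<and>
    (\<forall>i<n. if P (L @ take (Suc i) xs) then g c \<le> xs ! i else xs ! i \<le> g (Suc c)) \<and>
    c < a + 2 ^ n"
proof (induction n arbitrary: a L)
  case 0
  show ?case by (intro exI[of _ "[]"] exI[of _ a]) auto
next
  case (Suc n)
  \<comment> \<open>The midpoint \<open>e\<close> leaves \<open>2 ^ n\<close> indices on either side
    for the remaining \<open>n\<close> items.\<close>
  define e :: nat where "e = a + 2 ^ n"
  have e: "e \<ge> Suc a" by (simp add: e_def Suc_le_eq)
  \<comment> \<open>If \<open>P\<close> holds, later indices lie above \<open>e\<close>, so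
    \<open>e \<le> c\<close> and the item is at least \<open>g c\<close>. Otherwise the bound
    \<open>c < a + 2 ^ n\<close> from the induction hypothesis gives
    \<open>Suc c \<le> e\<close>.\<close>
  define a' where "a' = (if P (L @ [g e]) then e else a)"
  obtain xs c where xs: "length xs = n" "a' \<le> c" "set xs \<subseteq> g ` {Suc a'..}"
    "\<forall>i<n. if P ((L @ [g e]) @ take (Suc i) xs) then g c \<le> xs ! i else xs ! i \<le> g (Suc c)"
    "c < a' + 2 ^ n"
    using Suc[of a' "L @ [g e]"] by blast
  have a': "a \<le> a'" "a' \<le> e" using e by (auto simp: a'_def)
  have "set (g e # xs) \<subseteq> g ` {Suc a..}" using xs(3) a' e by fastforce
  moreover have "c < a + 2 ^ Suc n" using xs(5) a'(2) by (simp add: e_def)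
  moreover have "if P (L @ take (Suc i) (g e # xs)) then g c \<le> (g e # xs) ! i
      else (g e # xs) ! i \<le> g (Suc c)" if "i < Suc n" for i
  proof (cases i)
    case 0
    have "e \<le> c" if "P (L @ [g e])" using that xs(2) by (simp add: a'_def)
    moreover have "Suc c \<le> e" if "\<not> P (L @ [g e])"
      using that xs(5) by (simp add: a'_def e_def)
    ultimately show ?thesis using 0 antimonoD[OF g] by auto
  next
    case (Suc j)
    then show ?thesis using xs(4) that by auto
  qed
  ultimately show ?case
    using xs(1,2) a'(1) by (intro exI[of _ "g e # xs"] exI[of _ c]) auto
qed

text \<open>Bisection with \<open>P\<close> testing whether the newest item opens a bin. Powers of
  \<open>1 / k\<close> put a factor \<open>k\<close> between openers and other items; starting from
  index 1 makes all exponents at least 2.\<close>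

lemma adversarial_items:
  fixes k N :: nat
  assumes k: "k \<ge> 1"
  obtains xs c where "length xs = N" "c \<ge> 1"
    "\<And>x. x \<in> set xs \<Longrightarrow> 0 < x \<and> x \<le> (1 / real k) ^ 2"
    "\<And>i. i < N \<Longrightarrow> online_packing A xs i \<notin> online_packing A xs ` {..<i} \<Longrightarrow>
      (1 / real k) ^ c \<le> xs ! i"
    "\<And>i. i < N \<Longrightarrow> online_packing A xs i \<in> online_packing A xs ` {..<i} \<Longrightarrow>
      xs ! i \<le> (1 / real k) ^ Suc c"
proof -
  define g where "g n = (1 / real k) ^ n" for n
  have g: "antimono g"
    unfolding g_def antimono_def using k by (auto intro!: power_decreasing)
  define P where
    "P L \<longleftrightarrow> online_packing A L (length L - 1) \<notin> online_packing A L ` {..<length L - 1}" for L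
  obtain xs c where xs: "length xs = N" "1 \<le> c" "set xs \<subseteq> g ` {Suc 1..}"
    "\<forall>i<N. if P ([] @ take (Suc i) xs) then g c \<le> xs ! i else xs ! i \<le> g (Suc c)"
    using adaptive_sizes[OF g, of N 1 P "[]"] by blast
  \<comment> \<open>Online labels depend only on the prefix, so the test made on arrival agrees with
    the one on the complete list.\<close>
  have P: "P (take (Suc i) xs) \<longleftrightarrow> online_packing A xs i \<notin> online_packing A xs ` {..<i}"
    if "i < N" for i
  proof -
    have "online_packing A (take (Suc i) xs) j = online_packing A xs j" if "j \<le> i" for j
      using that by (simp add: online_packing_def min_def)
    then show ?thesis using that xs(1) by (auto simp: P_def image_iff)
  qed
  show ?thesis
  proof (rule that[OF xs(1,2)])
    fix x assume "x \<in> set xs"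
    then obtain n where "n \<in> {Suc 1..}" and gn: "x = g n" using xs(3) by blast
    then have n: "2 \<le> n" by simp
    then show "0 < x \<and> x \<le> (1 / real k) ^ 2"
      using antimonoD[OF g n] k gn by (auto simp: g_def)
  qed (use xs(4) P in \<open>auto simp: g_def\<close>)
qed

subsection \<open>The lower bound\<close>

text \<open>Both continuations are played after \<open>n * (k - 1)\<close> tiny items:
  \<open>X\<close> counts the bins used by then and \<open>Z\<close> the full ones among them. The
  last two inequalities come from the first and the second continuation.\<close>

lemma bins_trade_off:
  fixes A :: online_rule and r :: real
  assumes k: "k \<ge> 3" and A: "online_ccbp_algorithm k A"
    and ratio: "\<And>L. ccbp_input L \<Longrightarrow> K \<le> OPT k L \<Longrightarrow> real (alg_bins A L) \<le> r * real (OPT k L)"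
    and n: "n \<ge> 1" "n \<ge> 2 * K"
  obtains X Z where "n * (k - 1) \<le> (k - 1) * X + Z" "X \<le> n * (k - 1)" "r \<ge> 1"
    "real (Z + n) \<le> r * n"
    "real X + real ((n * (k - 1) - X) div (k - 1) + 1)
      \<le> r * (real ((n * (k - 1) - X) div (k - 1) + 1) + real (X div k + 1))"
proof -
  define N where "N = n * (k - 1)"
  have k1: "k \<ge> 1" using k by simp
  obtain xs c where xs: "length xs = N" and c: "c \<ge> 1"
    and tiny: "\<And>x. x \<in> set xs \<Longrightarrow> 0 < x \<and> x \<le> (1 / real k) ^ 2"
    and large: "\<And>i. i < N \<Longrightarrow> online_packing A xs i \<notin> online_packing A xs ` {..<i} \<Longrightarrow>
      (1 / real k) ^ c \<le> xs ! i"
    and small: "\<And>i. i < N \<Longrightarrow> online_packing A xs i \<in> online_packing A xs ` {..<i} \<Longrightarrow>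
      xs ! i \<le> (1 / real k) ^ Suc c"
    using adversarial_items[OF k1, of N A] by blast
  define p where "p = online_packing A xs"
  define full where "full = {b \<in> p ` {..<N}. card {i. i < N \<and> p i = b} = k}"
  define X where "X = num_bins xs p"
  define Z where "Z = card full"
  \<comment> \<open>The largest size that fits together with \<open>k - 1\<close> items of size
    \<open>s\<close>.\<close>
  define h where "h s = 1 - (real k - 1) * s" for s
  let ?in = "\<lambda>M s. xs @ replicate M (h s)"
  have sq: "(1 / real k) ^ 2 \<le> 1 / real k"
    using k by (simp add: power2_eq_square field_simps)
  \<comment> \<open>For \<open>s = (1 / k) ^ Suc j\<close> one has
    \<open>h s + (1 / k) ^ j = 1 + s\<close>, so an item of size \<open>(1 / k) ^ j\<close> just
    fails to fit.\<close>
  have h: "1 / 2 < h ((1 / real k) ^ Suc j)" "h ((1 / real k) ^ Suc j) \<le> 1"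
    "h ((1 / real k) ^ Suc j) + (1 / real k) ^ j > 1" if "j \<ge> 1" for j
  proof -
    let ?t = "(1 / real k) ^ Suc j"
    have t: "?t > 0" and kt: "real k * ?t = (1 / real k) ^ j" using k by auto
    have "(1 / real k) ^ j \<le> (1 / real k) ^ 1" using k that by (intro power_decreasing) auto
    also have "\<dots> \<le> 1 / 3" using k by (simp add: field_simps)
    finally have "real k * ?t \<le> 1 / 3" using kt by simp
    then have "1 / 2 < 1 - (real k * ?t - ?t)" using t by linarith
    then show "1 / 2 < h ?t" by (simp only: h_def left_diff_distrib mult_1_left)
    have "1 - (real k * ?t - ?t) + (1 / real k) ^ j > 1" using t kt by linarith
    then show "h ?t + (1 / real k) ^ j > 1" by (simp only: h_def left_diff_distrib mult_1_left)
    show "h ?t \<le> 1" using t k by (simp add: h_def)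
  qed
  have in_xs: "ccbp_input xs"
    using tiny sq k unfolding ccbp_input_def
    by (force intro: order_trans[of _ "1 / real k"])
  have input: "ccbp_input (?in M ((1 / real k) ^ Suc j))" if "j \<ge> 1" for M j
    using in_xs h[OF that] by (auto simp: ccbp_input_def set_replicate_conv_if)
  have feas: "feasible_packing k xs p"
    using A in_xs by (simp add: online_ccbp_algorithm_def p_def)
  \<comment> \<open>At most \<open>k\<close> items per bin and \<open>k \<le> 2 * (k - 1)\<close>
    give \<open>n \<le> 2 * OPT k L\<close>; hence the assumption
    \<open>n \<ge> 2 * K\<close>.\<close>
  have OPT_ge: "K \<le> OPT k L" "OPT k L > 0" if "ccbp_input L" "length L \<ge> N" for L
  proof -
    have "n * (k - 1) \<le> k * OPT k L"
      using length_le_OPT[OF that(1) k1] that(2) by (simp add: N_def)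
    then have "2 * (n * (k - 1)) \<le> 2 * (k * OPT k L)" by (rule mult_left_mono) simp
    moreover have "n * k \<le> n * (2 * (k - 1))" using k by (intro mult_left_mono) auto
    moreover have "n * (2 * (k - 1)) = 2 * (n * (k - 1))" "2 * (k * OPT k L) = (2 * OPT k L) * k"
      by (simp_all only: ac_simps)
    ultimately have "n * k \<le> (2 * OPT k L) * k" by linarith
    then have "n \<le> 2 * OPT k L" using k by simp
    then show "K \<le> OPT k L" "OPT k L > 0" using n by linarith+
  qed
  have alg: "real (card B + M) \<le> r * OPT k (?in M ((1 / real k) ^ Suc j))"
    if j: "j \<ge> 1" and B: "B \<subseteq> p ` {..<N}"
      and blocked: "\<And>b. b \<in> B \<Longrightarrow> card {i. i < N \<and> p i = b} = k
        \<or> (\<exists>i<N. p i = b \<and> xs ! i \<ge> (1 / real k) ^ j)" for B M j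
  proof -
    let ?s = "(1 / real k) ^ Suc j"
    let ?p = "online_packing A (?in M ?s)"
    have same: "?p i = p i" if "i < N" for i
      using that xs by (simp add: p_def online_packing_append)
    have "card B + M \<le> num_bins (?in M ?s) ?p"
    proof (rule num_bins_append_huge_ge)
      show "feasible_packing k (?in M ?s) ?p"
        using A input[OF j] by (simp add: online_ccbp_algorithm_def)
      show "1 / 2 < h ?s" using h[OF j] by simp
      show "B \<subseteq> ?p ` {..<length xs}" using B same xs by (auto simp: image_iff)
      show "x \<ge> 0" if "x \<in> set xs" for x using tiny[OF that] by simp
      fix b assume "b \<in> B"
      then have "card {i. i < N \<and> p i = b} = k \<or> (\<exists>i<N. p i = b \<and> xs ! i \<ge> (1 / real k) ^ j)"
        by (rule blocked)
      moreover have "{i. i < N \<and> p i = b} = {i. i < length xs \<and> ?p i = b}"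
        using same xs by auto
      moreover have "\<exists>i<length xs. ?p i = b \<and> xs ! i + h ?s > 1"
        if "i < N" "p i = b" "xs ! i \<ge> (1 / real k) ^ j" for i
        using that same xs h(3)[OF j] by (intro exI[of _ i]) auto
      ultimately show "card {i. i < length xs \<and> ?p i = b} = k
          \<or> (\<exists>i<length xs. ?p i = b \<and> xs ! i + h ?s > 1)"
        by metis
    qed
    also have "\<dots> = alg_bins A (?in M ?s)" by (simp add: alg_bins_def)
    finally have "real (card B + M) \<le> real (alg_bins A (?in M ?s))" by simp
    also have "\<dots> \<le> r * OPT k (?in M ?s)"
      using input[OF j] OPT_ge xs by (intro ratio) auto
    finally show ?thesis .
  qed
  have opt: "OPT k (?in M ((1 / real k) ^ Suc j)) \<le> M + Q"
    if S: "S \<subseteq> {..<N}" "\<And>i. i \<in> S \<Longrightarrow> xs ! i \<le> (1 / real k) ^ Suc j"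
      and MQ: "card S \<le> M * (k - 1)" "N - card S \<le> Q * k" for S M Q j
  proof (rule OPT_append_huge_le[where S = S and s = "(1 / real k) ^ Suc j"])
    show "xs ! i \<le> 1 / k" if "i < length xs" for i
      using tiny[of "xs ! i"] that sq by auto
  qed (use S MQ k1 xs in \<open>auto simp: h_def\<close>)

  \<comment> \<open>First continuation: \<open>j = 1\<close>, since all tiny items are at most
    \<open>(1 / k) ^ 2\<close>. The blocked bins are the full ones; for the optimum,
    \<open>S\<close> is everything and \<open>Q = 0\<close>.\<close>
  have first: "real (Z + n) \<le> r * OPT k (?in n ((1 / real k) ^ Suc 1))"
    unfolding Z_def by (rule alg) (auto simp: full_def)
  have "real (Z + n) > 0" using n by simp
  then have "r * OPT k (?in n ((1 / real k) ^ Suc 1)) > 0" using first by linarith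
  then have r: "r > 0" by (simp add: zero_less_mult_iff)
  have "OPT k (?in n ((1 / real k) ^ Suc 1)) \<le> n + 0"
    by (rule opt[where S = "{..<N}"])
       (use tiny xs in \<open>auto simp: N_def numeral_2_eq_2\<close>)
  then have "r * OPT k (?in n ((1 / real k) ^ Suc 1)) \<le> r * n"
    using r by (intro mult_left_mono) auto
  then have 1: "real (Z + n) \<le> r * n" using first by linarith
  then have "1 * real n \<le> r * real n" by simp
  then have r1: "r \<ge> 1" using n(1) by (subst (asm) mult_le_cancel_right) auto

  \<comment> \<open>Second continuation: \<open>j = c\<close>, and \<open>S\<close> consists of the
    items that do not open a bin. Every bin is blocked by its opener.\<close>
  define S where "S = {i. i < N \<and> p i \<in> p ` {..<i}}"
  have "S = {..<N} - {i. i < N \<and> p i \<notin> p ` {..<i}}" by (auto simp: S_def)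
  then have cardS: "card S = N - X"
    using card_first_occurrences[of N p] xs
    by (simp add: card_Diff_subset X_def num_bins_def subset_eq)
  have XN: "X \<le> N"
    using card_image_le[of "{..<N}" p] xs by (simp add: X_def num_bins_def)
  \<comment> \<open>Adding 1 after \<open>div\<close> is a crude rounding up; it costs at most one
    bin each time, negligible for large \<open>n\<close>.\<close>
  define M where "M = (N - X) div (k - 1) + 1"
  define Q where "Q = X div k + 1"
  have up: "m \<le> (m div d + 1) * d" if "d > 0" for m d :: nat
    using dividend_less_div_times[OF that, of m] by (simp add: add.commute)
  have "OPT k (?in M ((1 / real k) ^ Suc c)) \<le> M + Q"
  proof (rule opt)
    show "S \<subseteq> {..<N}" by (auto simp: S_def)
    show "xs ! i \<le> (1 / real k) ^ Suc c" if "i \<in> S" for i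
      using that small[of i] by (auto simp: S_def p_def)
    show "card S \<le> M * (k - 1)" unfolding cardS M_def using k by (intro up) auto
    show "N - card S \<le> Q * k" unfolding cardS Q_def using k XN up[of k X] by simp
  qed
  then have "r * OPT k (?in M ((1 / real k) ^ Suc c)) \<le> r * real (M + Q)"
    using r by (intro mult_left_mono) auto
  moreover have "real (card (p ` {..<N}) + M) \<le> r * OPT k (?in M ((1 / real k) ^ Suc c))"
  proof (rule alg[OF c])
    fix b assume "b \<in> p ` {..<N}"
    then obtain i where "i < N" "p i = b" "p i \<notin> p ` {..<i}" by (rule first_occurrence)
    then show "card {i. i < N \<and> p i = b} = k \<or> (\<exists>i<N. p i = b \<and> (1 / real k) ^ c \<le> xs ! i)"
      using large[of i] by (auto simp: p_def)
  qed simp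
  ultimately have 2: "real X + real M \<le> r * (real M + real Q)"
    using xs by (simp add: X_def num_bins_def)

  have "N \<le> (k - 1) * X + Z"
    using length_le_full_bins[OF feas k1] xs by (simp add: X_def Z_def full_def)
  then show ?thesis
    using that[of X Z] XN r1 1 2 unfolding N_def M_def Q_def by blast
qed

text \<open>Eliminating \<open>Z\<close> and \<open>X\<close> from the trade-off leaves
  \<open>n * q \<le> C\<close> for all large \<open>n\<close>, with \<open>C\<close> absorbing the
  rounding errors. Hence \<open>q \<le> 0\<close>, which is the quadratic inequality.\<close>

lemma ratio_quadratic:
  fixes A :: online_rule and r :: real
  assumes k: "k \<ge> 3" and A: "online_ccbp_algorithm k A"
    and ratio: "\<And>L. ccbp_input L \<Longrightarrow> K \<le> OPT k L \<Longrightarrow> real (alg_bins A L) \<le> r * real (OPT k L)"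
  shows "2 * real k ^ 3 - 4 * real k ^ 2 + real k
    \<le> r\<^sup>2 + (real k ^ 3 - real k ^ 2 - 2 * real k) * r"
proof (rule ccontr)
  define \<kappa> where "\<kappa> = real k"
  have kap: "\<kappa> \<ge> 3" using k by (simp add: \<kappa>_def)
  \<comment> \<open>The right side of the goal subtracted from the left, grouped as the elimination
    produces it.\<close>
  define q where "q = (1 - r) * \<kappa> * (\<kappa> - 1)\<^sup>2 + (\<kappa> - r) * (\<kappa>\<^sup>2 - 2 * \<kappa> + r)"
  assume "\<not> ?thesis"
  then have q: "q > 0"
    by (simp add: q_def \<kappa>_def power2_eq_square power3_eq_cube algebra_simps)
  define C where "C = 2 * r * \<kappa> * (\<kappa> - 1)\<^sup>2"
  have bound: "n * q \<le> C" if n: "n \<ge> 1" "n \<ge> 2 * K" for n :: nat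
  proof -
    obtain X Z where XZ: "n * (k - 1) \<le> (k - 1) * X + Z" "X \<le> n * (k - 1)" and r: "r \<ge> 1"
      and 1: "real (Z + n) \<le> r * n"
      and 2: "real X + real ((n * (k - 1) - X) div (k - 1) + 1)
        \<le> r * (real ((n * (k - 1) - X) div (k - 1) + 1) + real (X div k + 1))"
      using bins_trade_off[OF k A ratio n] by blast
    define M where "M = real ((n * (k - 1) - X) div (k - 1) + 1)"
    define x where "x = real X"
    have "M \<le> real (n * (k - 1) - X) / real (k - 1) + 1"
      unfolding M_def using of_nat_div_le_of_nat[of "n * (k - 1) - X" "k - 1", where ?'a = real]
      by simp
    also have "\<dots> = (n * (\<kappa> - 1) - x) / (\<kappa> - 1) + 1"
      using XZ(2) k by (simp add: of_nat_diff \<kappa>_def x_def)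
    finally have M: "M * (\<kappa> - 1) \<le> n * (\<kappa> - 1) - x + (\<kappa> - 1)"
      using kap by (simp add: field_simps)
    have "real (X div k + 1) \<le> x / \<kappa> + 1"
      using of_nat_div_le_of_nat[of X k, where ?'a = real] by (simp add: x_def \<kappa>_def)
    then have "r * (M + real (X div k + 1)) \<le> r * (M + (x / \<kappa> + 1))"
      using r by (intro mult_left_mono) auto
    then have "x + M \<le> r * (M + (x / \<kappa> + 1))"
      using 2 unfolding M_def x_def by linarith
    then have "(x + M) * \<kappa> \<le> r * (M * \<kappa> + x + \<kappa>)"
      using kap by (simp add: field_simps)
    then have "((x + M) * \<kappa>) * (\<kappa> - 1) \<le> (r * (M * \<kappa> + x + \<kappa>)) * (\<kappa> - 1)"
      using kap by (intro mult_right_mono) auto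
    \<comment> \<open>Solved for \<open>x\<close>, with \<open>M\<close> isolated in the form that
      its upper bound controls; its coefficient is nonnegative because
      \<open>r \<ge> 1\<close>.\<close>
    then have "x * (\<kappa> - r) * (\<kappa> - 1) \<le> (r - 1) * \<kappa> * (M * (\<kappa> - 1)) + r * \<kappa> * (\<kappa> - 1)"
      by (simp add: algebra_simps)
    also have "\<dots> \<le> (r - 1) * \<kappa> * (n * (\<kappa> - 1) - x + (\<kappa> - 1)) + r * \<kappa> * (\<kappa> - 1)"
      using M r kap by (intro add_right_mono mult_left_mono) auto
    finally have x: "x * (\<kappa>\<^sup>2 - 2 * \<kappa> + r)
        \<le> (r - 1) * \<kappa> * (n * (\<kappa> - 1)) + (2 * r - 1) * \<kappa> * (\<kappa> - 1)"
      by (simp add: algebra_simps power2_eq_square)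
    have "real (n * (k - 1)) \<le> real ((k - 1) * X + Z)" using XZ(1) by (rule of_nat_mono)
    then have "n * (\<kappa> - 1) \<le> (\<kappa> - 1) * x + Z"
      using k by (simp add: of_nat_diff \<kappa>_def x_def)
    \<comment> \<open>The first continuation gives \<open>Z \<le> (r - 1) * n\<close>, which
      eliminates \<open>Z\<close> and bounds \<open>x\<close> from below.\<close>
    then have "n * (\<kappa> - r) \<le> (\<kappa> - 1) * x"
      using 1 by (simp add: algebra_simps)
    \<comment> \<open>This factor is the coefficient of \<open>x\<close> in the upper bound, so
      multiplying by it lets the two bounds on \<open>x\<close> be chained.\<close>
    moreover have "\<kappa>\<^sup>2 - 2 * \<kappa> + r \<ge> 0"
      using kap r mult_right_mono[of 2 \<kappa> \<kappa>] by (simp add: power2_eq_square)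
    ultimately have "n * (\<kappa> - r) * (\<kappa>\<^sup>2 - 2 * \<kappa> + r) \<le> (\<kappa> - 1) * x * (\<kappa>\<^sup>2 - 2 * \<kappa> + r)"
      by (rule mult_right_mono)
    also have "\<dots> = (\<kappa> - 1) * (x * (\<kappa>\<^sup>2 - 2 * \<kappa> + r))" by simp
    also have "\<dots> \<le> (\<kappa> - 1) *
        ((r - 1) * \<kappa> * (n * (\<kappa> - 1)) + (2 * r - 1) * \<kappa> * (\<kappa> - 1))"
      using x kap by (intro mult_left_mono) auto
    finally have "n * q \<le> (2 * r - 1) * \<kappa> * (\<kappa> - 1)\<^sup>2"
      by (simp add: q_def power2_eq_square algebra_simps)
    also have "\<dots> \<le> C"
      unfolding C_def using kap by (intro mult_right_mono) auto
    finally show ?thesis .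
  qed
  obtain m :: nat where m: "C < m * q" using reals_Archimedean3[OF q] by blast
  have "m * q \<le> real (m + 2 * K + 1) * q" using q by (intro mult_right_mono) auto
  then show False using m bound[of "m + 2 * K + 1"] by simp
qed

section \<open>From the asymptotic ratio to the explicit root\<close>

lemma asymptotic_ratio_less:
  assumes "asymptotic_competitive_ratio k A < ereal R"
  obtains r K where "r < R"
    "\<And>L. ccbp_input L \<Longrightarrow> K \<le> OPT k L \<Longrightarrow> real (alg_bins A L) \<le> r * real (OPT k L)"
proof -
  obtain r where r: "asymptotic_competitive_ratio k A < ereal r" "ereal r < ereal R"
    using ereal_dense2[OF assms] by blast
  have "eventually (\<lambda>K. sup_ratio k A K < ereal r) sequentially"
    using sup_ratio_tendsto r(1) by (rule order_tendstoD)
  then obtain K0 where K0: "\<And>K. K \<ge> K0 \<Longrightarrow> sup_ratio k A K < ereal r"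
    by (auto simp: eventually_sequentially)
  show ?thesis
  proof (rule that)
    show "r < R" using r(2) by simp
    \<comment> \<open>The threshold \<open>Suc K0\<close> keeps the optimum positive, so the
      quotient can be cleared.\<close>
    fix L assume L: "ccbp_input L" "Suc K0 \<le> OPT k L"
    have "ereal (real (alg_bins A L) / real (OPT k L)) \<le> sup_ratio k A (Suc K0)"
      unfolding sup_ratio_def using L by (intro SUP_upper) auto
    also have "\<dots> < ereal r" by (rule K0) simp
    finally have "real (alg_bins A L) / real (OPT k L) < r" by simp
    moreover have "real (OPT k L) > 0" using L(2) by simp
    ultimately show "real (alg_bins A L) \<le> r * real (OPT k L)"
      by (simp add: field_simps)
  qed
qed

theorem theorem6:
  fixes k :: nat and A :: online_rule
  assumes "k \<ge> 3"
    and "online_ccbp_algorithm k A"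
  shows "asymptotic_competitive_ratio k A \<ge>
    ereal ((2 * real k + real k ^ 2 - real k ^ 3 +
            sqrt (real k ^ 6 - 2 * real k ^ 5 - 3 * real k ^ 4 + 12 * real k ^ 3
                  - 12 * real k ^ 2 + 4 * real k)) / 2)"
proof (rule ccontr)
  \<comment> \<open>The claimed bound is the larger root of \<open>r\<^sup>2 + b * r - c\<close>,
    with discriminant \<open>b\<^sup>2 + 4 * c\<close>.\<close>
  define b where "b = real k ^ 3 - real k ^ 2 - 2 * real k"
  define c where "c = 2 * real k ^ 3 - 4 * real k ^ 2 + real k"
  let ?D = "real k ^ 6 - 2 * real k ^ 5 - 3 * real k ^ 4 + 12 * real k ^ 3
    - 12 * real k ^ 2 + 4 * real k"
  have D: "?D = b\<^sup>2 + 4 * c"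
    by (simp add: b_def c_def eval_nat_numeral algebra_simps)
  assume "\<not> ?thesis"
  then obtain r K where r: "r < (2 * real k + real k ^ 2 - real k ^ 3 + sqrt ?D) / 2"
    and ratio: "\<And>L. ccbp_input L \<Longrightarrow> K \<le> OPT k L \<Longrightarrow> real (alg_bins A L) \<le> r * real (OPT k L)"
    using asymptotic_ratio_less[of k A] unfolding not_le by metis
  \<comment> \<open>Only \<open>r \<ge> 1\<close> is taken from the trade-off: with
    \<open>b \<ge> 0\<close> it makes \<open>2 * r + b\<close> nonnegative, so the comparison with
    the square root may be squared.\<close>
  obtain X Z where "r \<ge> 1"
    using bins_trade_off[OF assms ratio, of "2 * K + 1"] by fastforce
  moreover have "b \<ge> 0"
  proof -
    have "0 \<le> real k * (real k - 2) * (real k + 1)" using assms(1) by simp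
    then show ?thesis by (simp add: b_def eval_nat_numeral algebra_simps)
  qed
  ultimately have nonneg: "2 * r + b \<ge> 0" by simp
  have "2 * r + b < sqrt (b\<^sup>2 + 4 * c)" using r D by (simp add: b_def)
  then have "(2 * r + b)\<^sup>2 < b\<^sup>2 + 4 * c"
    by (meson not_less real_le_lsqrt nonneg)
  then have "r\<^sup>2 + b * r < c" by (simp add: power2_eq_square algebra_simps)
  then show False
    using ratio_quadratic[OF assms ratio] by (simp add: b_def c_def)
qed

end
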